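(* Let $n\geqslant 1$ be an integer. The monoid $\mathcal{PIO}_n$ of all order-preserving partial transformations of the chain $\Omega_n=\{1,\ldots,n\}$ whose domains and images are intervals of $\Omega_n$ has cardinality $$\lvert \mathcal{PIO}_{n}\rvert=(n+3)2^n-n^2-3n-2.$$
   Context: $\Omega_n=\{1,\ldots,n\}$ with its natural order. A partial transformation of $\Omega_n$ is a map $\alpha$ from a subset $\operatorname{Dom}(\alpha)\subseteq\Omega_n$ (possibly empty) into $\Omega_n$, with image $\operatorname{Im}(\alpha)$. Maps are written on the right and composed from left to right: $x(\alpha\beta)=(x\alpha)\beta$, with $\operatorname{Dom}(\alpha\beta)=\{x\in\operatorname{Dom}(\alpha)\mid x\alpha\in\operatorname{Dom}(\beta)\}$. $\alpha$ is order-preserving if $x\leqslant y$ implies $x\alpha\leqslant y\alpha$ for all $x,y\in\operatorname{Dom}(\alpha)$. A subset $I\subseteq\Omega_n$ (possibly empty) is an interval if for all $x,y,z\in\Omega_n$, $x\leqslant y\leqslant z$ and $x,z\in I$ imply $y\in I$. $\mathcal{PIO}_n$ is the monoid, under composition, of all order-preserving partial transformations $\alpha$ of $\Omega_n$ such that $\operatorname{Dom}(\alpha)$ and $\operatorname{Im}(\alpha)$ are both intervals of $\Omega_n$ (it includes the empty transformation). *)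

theory Defs
  imports "HOL-Algebra.Coset"
begin

definition Omega :: "nat \<Rightarrow> nat set"
  where "Omega n = {1..n}"

definition partial_transformation :: "nat \<Rightarrow> (nat \<rightharpoonup> nat) \<Rightarrow> bool"
  where "partial_transformation n \<alpha> \<longleftrightarrow> dom \<alpha> \<subseteq> Omega n \<and> ran \<alpha> \<subseteq> Omega n"

definition order_preserving :: "(nat \<rightharpoonup> nat) \<Rightarrow> bool"
  where "order_preserving \<alpha> \<longleftrightarrow>
    (\<forall>x \<in> dom \<alpha>. \<forall>y \<in> dom \<alpha>. x \<le> y \<longrightarrow> the (\<alpha> x) \<le> the (\<alpha> y))"

definition interval_of :: "nat \<Rightarrow> nat set \<Rightarrow> bool"
  where "interval_of n I \<longleftrightarrow> I \<subseteq> Omega n \<and>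
    (\<forall>x \<in> Omega n. \<forall>y \<in> Omega n. \<forall>z \<in> Omega n.
      x \<le> y \<and> y \<le> z \<and> x \<in> I \<and> z \<in> I \<longrightarrow> y \<in> I)"

text \<open>Products are composed from left to right, whereas \<open>\<circ>\<^sub>m\<close> applies its right argument first.\<close>

definition PIO :: "nat \<Rightarrow> (nat \<rightharpoonup> nat) monoid"
  where "PIO n =
    \<lparr>carrier = {\<alpha>. partial_transformation n \<alpha> \<and> order_preserving \<alpha> \<and>
        interval_of n (dom \<alpha>) \<and> interval_of n (ran \<alpha>)},
     monoid.mult = (\<lambda>\<alpha> \<beta>. \<beta> \<circ>\<^sub>m \<alpha>),
     one = (\<lambda>x. if x \<in> Omega n then Some x else None)\<rparr>"

lemma PIO_mult_closed:
  assumes a: "\<alpha> \<in> carrier (PIO n)" and b: "\<beta> \<in> carrier (PIO n)"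
  shows "\<alpha> \<otimes>\<^bsub>PIO n\<^esub> \<beta> \<in> carrier (PIO n)"
proof -
  have mono: "u \<le> v" if "\<gamma> x = Some u" "\<gamma> y = Some v" "x \<le> y" "\<gamma> \<in> carrier (PIO n)" for \<gamma> x y u v
    using that unfolding PIO_def order_preserving_def by (force simp: domI)
  have Om: "x \<in> Omega n \<and> u \<in> Omega n" if "\<gamma> x = Some u" "\<gamma> \<in> carrier (PIO n)" for \<gamma> x u
    using that unfolding PIO_def partial_transformation_def by (auto simp: ranI domI subset_iff)
  have Id: "\<exists>v. \<gamma> y = Some v" if "\<gamma> x = Some u" "\<gamma> z = Some w" "x \<le> y" "y \<le> z" "\<gamma> \<in> carrier (PIO n)"
    for \<gamma> x y z u w
  proof -
    have "y \<in> Omega n"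
      using Om[OF that(1,5)] Om[OF that(2,5)] that(3,4) by (auto simp: Omega_def)
    moreover have "interval_of n (dom \<gamma>)" using that by (simp add: PIO_def)
    ultimately have "y \<in> dom \<gamma>"
      using that Om[OF that(1,5)] Om[OF that(2,5)] unfolding interval_of_def by blast
    then show ?thesis by blast
  qed
  have Ir: "\<exists>y. \<gamma> y = Some v" if "\<gamma> x = Some u" "\<gamma> z = Some w" "u \<le> v" "v \<le> w" "\<gamma> \<in> carrier (PIO n)"
    for \<gamma> x z u v w
  proof -
    have "v \<in> Omega n"
      using Om[OF that(1,5)] Om[OF that(2,5)] that(3,4) by (auto simp: Omega_def)
    moreover have "interval_of n (ran \<gamma>)" using that by (simp add: PIO_def)
    ultimately have "v \<in> ran \<gamma>"
      using that Om[OF that(1,5)] Om[OF that(2,5)] unfolding interval_of_def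
      by (metis ranI)
    then show ?thesis by (auto simp: ran_def)
  qed
  let ?c = "\<beta> \<circ>\<^sub>m \<alpha>"
  have "partial_transformation n ?c"
    unfolding partial_transformation_def
    by (auto simp: map_comp_Some_iff ran_def dest: Om[OF _ a] Om[OF _ b])
  moreover have "order_preserving ?c"
    unfolding order_preserving_def
    by (clarsimp simp: map_comp_Some_iff) (meson mono a b)
  moreover have "interval_of n (dom ?c)"
  proof -
    have "\<exists>p. ?c y = Some p"
      if xz: "?c x = Some p1" "?c z = Some p2" and l: "x \<le> y" "y \<le> z" for x y z p1 p2
    proof -
      from xz obtain u w where u: "\<alpha> x = Some u" "\<beta> u = Some p1" and w: "\<alpha> z = Some w" "\<beta> w = Some p2"
        by (auto simp: map_comp_Some_iff)
      obtain v where v: "\<alpha> y = Some v" using Id[OF u(1) w(1) l a] by blast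
      have "\<exists>p. \<beta> v = Some p"
        using Id[OF u(2) w(2) mono[OF u(1) v l(1) a] mono[OF v w(1) l(2) a] b] .
      with v show ?thesis by (auto simp: map_comp_Some_iff)
    qed
    with \<open>partial_transformation n ?c\<close> show ?thesis
      unfolding interval_of_def partial_transformation_def by (metis domD domI)
  qed
  moreover have "interval_of n (ran ?c)"
  proof -
    have "q \<in> ran ?c"
      if xz: "?c x = Some p" "?c z = Some r" and l: "p \<le> q" "q \<le> r" for x z p q r
    proof -
      from xz obtain u w where u: "\<alpha> x = Some u" "\<beta> u = Some p" and w: "\<alpha> z = Some w" "\<beta> w = Some r"
        by (auto simp: map_comp_Some_iff)
      obtain v where v: "\<beta> v = Some q" using Ir[OF u(2) w(2) l b] by blast
      consider "q = p" | "q = r" | "p < q" "q < r" using l by linarith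
      then show ?thesis
      proof cases
        case 3
        have "u \<le> v" using mono[OF v u(2) _ b] 3 by force
        moreover have "v \<le> w" using mono[OF w(2) v _ b] 3 by force
        ultimately obtain y where "\<alpha> y = Some v" using Ir[OF u(1) w(1) _ _ a] by blast
        with v have "?c y = Some q" by (simp add: map_comp_Some_iff)
        then show ?thesis by (rule ranI)
      qed (use xz in \<open>auto intro: ranI\<close>)
    qed
    then have "q \<in> ran ?c" if "p \<in> ran ?c" "r \<in> ran ?c" "p \<le> q" "q \<le> r" for p q r
      using that unfolding ran_def by blast
    with \<open>partial_transformation n ?c\<close> show ?thesis
      unfolding interval_of_def partial_transformation_def by blast
  qed
  ultimately show ?thesis by (simp add: PIO_def)
qed

lemma PIO_monoid: "monoid (PIO n)"
proof (rule monoidI)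
  show "\<one>\<^bsub>PIO n\<^esub> \<in> carrier (PIO n)"
    by (auto simp: PIO_def partial_transformation_def order_preserving_def interval_of_def
        dom_def ran_def)
next
  fix \<alpha> \<beta> \<gamma>
  show "\<alpha> \<otimes>\<^bsub>PIO n\<^esub> \<beta> \<otimes>\<^bsub>PIO n\<^esub> \<gamma> = \<alpha> \<otimes>\<^bsub>PIO n\<^esub> (\<beta> \<otimes>\<^bsub>PIO n\<^esub> \<gamma>)"
    by (auto simp: PIO_def map_comp_def fun_eq_iff split: option.splits)
next
  fix \<alpha>
  assume "\<alpha> \<in> carrier (PIO n)"
  then have d: "dom \<alpha> \<subseteq> Omega n" and r: "ran \<alpha> \<subseteq> Omega n"
    by (auto simp: PIO_def partial_transformation_def)
  have "\<alpha> x = None" if "x \<notin> Omega n" for x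
    using d that by blast
  then show "\<one>\<^bsub>PIO n\<^esub> \<otimes>\<^bsub>PIO n\<^esub> \<alpha> = \<alpha>"
    by (simp add: PIO_def map_comp_def fun_eq_iff)
  have "u \<in> Omega n" if "\<alpha> x = Some u" for x u
    using r ranI[of \<alpha> x u] that by blast
  then show "\<alpha> \<otimes>\<^bsub>PIO n\<^esub> \<one>\<^bsub>PIO n\<^esub> = \<alpha>"
    by (auto simp: PIO_def map_comp_def fun_eq_iff split: option.splits)
qed (rule PIO_mult_closed)

end

theory Submission
  imports Defs
begin

text \<open>
  Let \<open>\<alpha>\<close> be a nonempty element of the monoid, with domain \<open>{a..a + m}\<close> and \<open>\<alpha> a = b\<close>. Going from
  \<open>a + i\<close> to \<open>a + i + 1\<close>, the value of \<open>\<alpha>\<close> cannot decrease, and it cannot increase by more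
  than 1: monotonicity prevents a skipped value from being taken elsewhere, so skipping it would
  leave a hole in the image. Hence \<open>\<alpha>\<close> is a staircase, determined by \<open>a\<close>, \<open>m\<close>, \<open>b\<close> and the
  set \<open>S \<subseteq> {..<m}\<close> of the steps at which it climbs, and its image is \<open>{b..b + card S}\<close>.
  Conversely all such data with \<open>1 \<le> a\<close>, \<open>a + m \<le> n\<close>, \<open>1 \<le> b\<close> and \<open>b + card S \<le> n\<close> give an
  element, and different data give different elements
  (\<open>stair_in_carrier\<close>, \<open>stair_inj\<close>, \<open>stair_surj\<close>).

  For given \<open>m\<close> there are \<open>n - m\<close> choices of \<open>a\<close>, and for given \<open>S\<close> there are \<open>n - card S\<close> choices
  of \<open>b\<close>. As the average cardinality of a subset of \<open>{..<m}\<close> is \<open>m / 2\<close>, the number of nonempty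
  elements is \<open>\<Sum>m<n. (n - m) * (2 * n - m) * 2 ^ m / 2\<close>, which has the closed form
  \<open>(n + 3) * 2 ^ n - n\<^sup>2 - 3 * n - 3\<close>. The empty transformation accounts for the missing 1.
\<close>

section \<open>Intervals\<close>

lemma interval_of_iff:
  "interval_of n I \<longleftrightarrow> I = {} \<or> (\<exists>a m. 1 \<le> a \<and> a + m \<le> n \<and> I = {a..a + m})"
proof
  assume I: "interval_of n I"
  show "I = {} \<or> (\<exists>a m. 1 \<le> a \<and> a + m \<le> n \<and> I = {a..a + m})"
  proof (cases "I = {}")
    case False
    have sub: "I \<subseteq> {1..n}" using I by (simp add: interval_of_def Omega_def)
    then have fin: "finite I" by (rule finite_subset) simp
    have mem: "Min I \<in> I" "Max I \<in> I" using fin False by auto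
    have le: "Min I \<le> Max I" using fin mem by simp
    have "I = {Min I..Max I}"
    proof
      show "I \<subseteq> {Min I..Max I}" using fin by auto
      show "{Min I..Max I} \<subseteq> I"
      proof
        fix y assume y: "y \<in> {Min I..Max I}"
        have "Min I \<in> Omega n" "Max I \<in> Omega n" using mem sub by (auto simp: Omega_def)
        moreover from this y have "y \<in> Omega n" by (auto simp: Omega_def)
        moreover have "Min I \<le> y" "y \<le> Max I" using y by simp_all
        ultimately show "y \<in> I" using I mem unfolding interval_of_def by blast
      qed
    qed
    moreover have "1 \<le> Min I" "Max I \<le> n" using mem sub by auto
    ultimately have "1 \<le> Min I \<and> Min I + (Max I - Min I) \<le> n \<and> I = {Min I..Min I + (Max I - Min I)}"
      using le by simp
    then show ?thesis by blast
  qed simp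
qed (auto simp: interval_of_def Omega_def)

section \<open>Staircases\<close>

definition climb :: "nat set \<Rightarrow> nat \<Rightarrow> nat"
  where "climb S i = card (S \<inter> {..<i})"

lemma climb_0 [simp]: "climb S 0 = 0"
  by (simp add: climb_def)

lemma climb_Suc [simp]: "climb S (Suc i) = climb S i + (if i \<in> S then 1 else 0)"
  by (simp add: climb_def lessThan_Suc Int_insert_right)

lemma climb_mono: "i \<le> j \<Longrightarrow> climb S i \<le> climb S j"
  unfolding climb_def by (intro card_mono) auto

lemma climb_full: "S \<subseteq> {..<m} \<Longrightarrow> climb S m = card S"
  by (simp add: climb_def Int_absorb2)

text \<open>A discrete intermediate value property: steps of height at most 1 skip no value.\<close>

lemma climb_image: "climb S ` {..m} = {..climb S m}"
  by (induction m) (auto simp: atMost_Suc)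

lemma climb_eqD:
  assumes "S \<subseteq> {..<m}" "T \<subseteq> {..<m}" "\<And>i. i \<le> m \<Longrightarrow> climb S i = climb T i"
  shows "S = T"
proof -
  have "i \<in> S \<longleftrightarrow> i \<in> T" if "i < m" for i
    using assms(3)[of i] assms(3)[of "Suc i"] that by (auto split: if_splits)
  then show ?thesis using assms(1,2) by blast
qed

definition stair :: "nat \<Rightarrow> nat \<Rightarrow> nat set \<Rightarrow> nat \<Rightarrow> (nat \<rightharpoonup> nat)"
  where "stair m a S b = (\<lambda>x. if x \<in> {a..a + m} then Some (b + climb S (x - a)) else None)"

lemma dom_stair: "dom (stair m a S b) = {a..a + m}"
  by (auto simp: stair_def dom_def)

lemma stair_apply: "i \<le> m \<Longrightarrow> stair m a S b (a + i) = Some (b + climb S i)"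
  by (simp add: stair_def)

lemma ran_stair:
  assumes "S \<subseteq> {..<m}"
  shows "ran (stair m a S b) = {b..b + card S}"
proof -
  have "ran (stair m a S b) = (\<lambda>x. b + climb S (x - a)) ` {a..a + m}"
    by (auto simp: stair_def ran_def)
  also have "{a..a + m} = (+) a ` {..m}"
    by (simp add: atMost_atLeast0)
  also have "(\<lambda>x. b + climb S (x - a)) ` (+) a ` {..m} = (+) b ` climb S ` {..m}"
    by (simp add: image_image)
  also have "\<dots> = {b..b + card S}"
    by (simp only: climb_image climb_full[OF assms]) (simp add: atMost_atLeast0)
  finally show ?thesis .
qed

lemma stair_in_carrier:
  assumes "1 \<le> a" "a + m \<le> n" "S \<subseteq> {..<m}" "1 \<le> b" "b + card S \<le> n"
  shows "stair m a S b \<in> carrier (PIO n)"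
proof -
  have "interval_of n (dom (stair m a S b))"
    unfolding interval_of_iff dom_stair using assms by blast
  moreover have "interval_of n (ran (stair m a S b))"
    unfolding interval_of_iff ran_stair[OF assms(3)] using assms by blast
  moreover have "order_preserving (stair m a S b)"
    unfolding order_preserving_def dom_stair by (auto simp: stair_def intro: climb_mono)
  moreover have "partial_transformation n (stair m a S b)"
    unfolding partial_transformation_def dom_stair ran_stair[OF assms(3)]
    using assms by (auto simp: Omega_def)
  ultimately show ?thesis by (simp add: PIO_def)
qed

text \<open>The domain is never empty, so it determines \<open>a\<close> and \<open>m\<close>; the first value is \<open>b\<close>, and
  the later values determine the climbing set.\<close>

lemma stair_inj:
  assumes eq: "stair m a S b = stair m' a' S' b'" and S: "S \<subseteq> {..<m}" "S' \<subseteq> {..<m'}"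
  shows "m = m' \<and> a = a' \<and> S = S' \<and> b = b'"
proof -
  have "{a..a + m} = {a'..a' + m'}"
    using arg_cong[OF eq, of dom] by (simp only: dom_stair)
  then have am: "a = a'" "m = m'" by (simp_all add: Icc_eq_Icc)
  have same: "b + climb S i = b' + climb S' i" if "i \<le> m" for i
    using that eq stair_apply[of i m a S b] stair_apply[of i m a S' b'] by (simp add: am)
  from same[of 0] have "b = b'" by simp
  with same S am have "S = S'" by (intro climb_eqD[of S m S']) auto
  with am \<open>b = b'\<close> show ?thesis by simp
qed

text \<open>The climbing set is read off as the set of steps at which the value changes. That it
  describes the map completely rests on the image being an interval, which bounds every step by 1.\<close>

lemma stair_surj:
  assumes c: "\<alpha> \<in> carrier (PIO n)" and ne: "\<alpha> \<noteq> Map.empty"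
  obtains m a S b where "1 \<le> a" "a + m \<le> n" "S \<subseteq> {..<m}" "1 \<le> b" "b + card S \<le> n"
    "\<alpha> = stair m a S b"
proof -
  have "interval_of n (dom \<alpha>)" "dom \<alpha> \<noteq> {}" using c ne by (auto simp: PIO_def)
  then obtain a m where am: "1 \<le> a" "a + m \<le> n" and dom: "dom \<alpha> = {a..a + m}"
    unfolding interval_of_iff by blast
  have "interval_of n (ran \<alpha>)" using c by (simp add: PIO_def)
  moreover have "ran \<alpha> \<noteq> {}" using \<open>dom \<alpha> \<noteq> {}\<close> by (blast intro: ranI)
  ultimately obtain b k where bk: "1 \<le> b" "b + k \<le> n" and ran: "ran \<alpha> = {b..b + k}"
    unfolding interval_of_iff by blast
  define f where "f i = the (\<alpha> (a + i))" for i
  have f: "\<alpha> (a + i) = Some (f i)" if "i \<le> m" for i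
  proof -
    have "a + i \<in> dom \<alpha>" using that by (simp add: dom)
    then show ?thesis by (auto simp: f_def)
  qed
  have mono: "f i \<le> f j" if "i \<le> j" "j \<le> m" for i j
  proof -
    have "a + i \<in> dom \<alpha>" "a + j \<in> dom \<alpha>" using that by (simp_all add: dom)
    then show ?thesis using c that by (simp add: PIO_def order_preserving_def f_def)
  qed
  have im: "f ` {..m} = {b..b + k}"
  proof -
    have "y \<in> f ` {..m}" if "\<alpha> x = Some y" for x y
    proof -
      from that have "x \<in> {a..a + m}" using dom by blast
      then obtain i where "i \<le> m" "x = a + i" by (auto simp: le_iff_add)
      with f[of i] that show ?thesis by auto
    qed
    then have "ran \<alpha> \<subseteq> f ` {..m}" by (auto simp: ran_def)
    moreover have "f ` {..m} \<subseteq> ran \<alpha>" using f by (auto intro: ranI)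
    ultimately show ?thesis using ran by simp
  qed
  have range: "f i \<in> {b..b + k}" if "i \<le> m" for i
    using im that by (metis atMost_iff imageI)
  have step: "f (Suc i) \<le> Suc (f i)" if "i < m" for i
  proof (rule ccontr)
    \<comment> \<open>The skipped value lies in the image, but monotonicity leaves no argument that attains it.\<close>
    assume skip: "\<not> f (Suc i) \<le> Suc (f i)"
    with range[of i] range[of "Suc i"] that have "Suc (f i) \<in> {b..b + k}" by simp
    then obtain j where j: "j \<le> m" "f j = Suc (f i)" using im by (metis atMost_iff imageE)
    show False
    proof (cases "j \<le> i")
      case True
      with mono[of j i] j that show False by simp
    next
      case False
      with mono[of "Suc i" j] j skip show False by simp
    qed
  qed
  define S where "S = {i. i < m \<and> f (Suc i) \<noteq> f i}"
  have f_eq: "f i = f 0 + climb S i" if "i \<le> m" for i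
    using that
  proof (induction i)
    case (Suc i)
    then show ?case using step[of i] mono[of i "Suc i"] by (auto simp: S_def)
  qed simp
  have S: "S \<subseteq> {..<m}" by (auto simp: S_def)
  have "\<alpha> x = stair m a S (f 0) x" for x
  proof (cases "x \<in> {a..a + m}")
    case True
    then obtain i where "i \<le> m" "x = a + i" by (auto simp: le_iff_add)
    then show ?thesis using f[of i] f_eq[of i] by (simp add: stair_apply)
  next
    case False
    then show ?thesis using dom by (auto simp: stair_def)
  qed
  moreover have "f 0 + card S \<le> n"
    using range[of m] bk f_eq[of m] by (simp add: climb_full[OF S])
  moreover have "1 \<le> f 0" using range[of 0] bk by simp
  ultimately show ?thesis using that am S by blast
qed

section \<open>Counting the staircases\<close>

definition stairs :: "nat \<Rightarrow> (nat \<times> nat \<times> nat set \<times> nat) set"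
  where "stairs n = (SIGMA m:{..<n}. {1..n - m} \<times> (SIGMA S:Pow {..<m}. {1..n - card S}))"

lemma mem_stairs:
  "(m, a, S, b) \<in> stairs n \<longleftrightarrow>
    1 \<le> a \<and> a + m \<le> n \<and> S \<subseteq> {..<m} \<and> 1 \<le> b \<and> b + card S \<le> n"
  unfolding stairs_def by auto

lemma finite_stairs: "finite (stairs n)"
  unfolding stairs_def by (intro finite_SigmaI finite_cartesian_product) auto

lemma carrier_PIO_eq:
  "carrier (PIO n) = insert Map.empty ((\<lambda>(m, a, S, b). stair m a S b) ` stairs n)"
proof (intro equalityI subsetI)
  fix \<alpha> assume c: "\<alpha> \<in> carrier (PIO n)"
  show "\<alpha> \<in> insert Map.empty ((\<lambda>(m, a, S, b). stair m a S b) ` stairs n)"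
  proof (cases "\<alpha> = Map.empty")
    case False
    then obtain m a S b where "(m, a, S, b) \<in> stairs n" "\<alpha> = stair m a S b"
      using stair_surj[OF c] mem_stairs by metis
    then show ?thesis by force
  qed simp
next
  fix \<alpha> assume "\<alpha> \<in> insert Map.empty ((\<lambda>(m, a, S, b). stair m a S b) ` stairs n)"
  then consider "\<alpha> = Map.empty"
    | m a S b where "(m, a, S, b) \<in> stairs n" "\<alpha> = stair m a S b" by auto
  then show "\<alpha> \<in> carrier (PIO n)"
  proof cases
    case 1
    then show ?thesis
      by (simp add: PIO_def partial_transformation_def order_preserving_def interval_of_iff)
  next
    case 2
    then show ?thesis by (simp add: mem_stairs stair_in_carrier)
  qed
qed

lemma order_PIO_eq: "order (PIO n) = Suc (card (stairs n))"
proof -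
  let ?f = "\<lambda>(m, a, S, b). stair m a S b"
  have "stair m a S b \<noteq> Map.empty" for m a S b
    using dom_stair[of m a S b] by auto
  then have "Map.empty \<notin> ?f ` stairs n" by (auto dest: sym)
  moreover have "inj_on ?f (stairs n)"
    by (rule inj_onI) (auto simp: mem_stairs dest!: stair_inj)
  ultimately show ?thesis
    by (simp add: order_def carrier_PIO_eq finite_stairs card_image)
qed

text \<open>Pairing each subset with its complement shows that the average cardinality is half of the
  full one; the doubled sum avoids division.\<close>

lemma sum_card_Pow:
  assumes "finite A"
  shows "2 * (\<Sum>S\<in>Pow A. card S) = card A * 2 ^ card A"
proof -
  have "(\<Sum>S\<in>Pow A. card S) = (\<Sum>S\<in>Pow A. card (A - S))"
    by (rule sum.reindex_bij_witness[of _ "\<lambda>S. A - S" "\<lambda>S. A - S"]) (auto simp: double_diff)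
  then have "2 * (\<Sum>S\<in>Pow A. card S) = (\<Sum>S\<in>Pow A. card S + card (A - S))"
    by (simp add: sum.distrib)
  also have "\<dots> = (\<Sum>S\<in>Pow A. card A)"
    using assms by (intro sum.cong refl) (simp add: card_Diff_subset card_mono finite_subset)
  also have "\<dots> = card A * 2 ^ card A" using assms by (simp add: card_Pow)
  finally show ?thesis .
qed

lemma card_climb_sets_with_start:
  assumes "m < n"
  shows "2 * int (card (SIGMA S:Pow {..<m}. {1..n - card S})) = (2 * int n - int m) * 2 ^ m"
proof -
  have le: "card S \<le> n" if "S \<in> Pow {..<m}" for S
    using that card_mono[of "{..<m}" S] assms by simp
  have "int (card (SIGMA S:Pow {..<m}. {1..n - card S})) = (\<Sum>S\<in>Pow {..<m}. int (n - card S))"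
    by (simp add: card_SigmaI)
  also have "\<dots> = (\<Sum>S\<in>Pow {..<m}. int n - int (card S))"
    using le by (intro sum.cong refl) (simp add: of_nat_diff)
  also have "\<dots> = 2 ^ m * int n - int (\<Sum>S\<in>Pow {..<m}. card S)"
    by (simp add: sum_subtractf card_Pow)
  finally have "2 * int (card (SIGMA S:Pow {..<m}. {1..n - card S}))
      = 2 * (2 ^ m * int n) - int (2 * (\<Sum>S\<in>Pow {..<m}. card S))"
    by simp
  also have "int (2 * (\<Sum>S\<in>Pow {..<m}. card S)) = int m * 2 ^ m"
    by (subst sum_card_Pow) simp_all
  finally show ?thesis by (simp add: algebra_simps)
qed

text \<open>Separating the bound of the sum from the parameter \<open>N\<close> makes induction possible. The
  quadratic factor is found by the ansatz that it has the form \<open>A + B * k + k\<^sup>2\<close> with \<open>A\<close> and \<open>B\<close>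
  depending on \<open>N\<close> only.\<close>

lemma sum_quadratic_times_power:
  fixes N :: int
  shows "(\<Sum>m<k. (N - int m) * ((2 * N - int m) * 2 ^ m)) =
    (2 * N\<^sup>2 + 6 * N + 6 - (3 * N + 4) * int k + (int k)\<^sup>2) * 2 ^ k - (2 * N\<^sup>2 + 6 * N + 6)"
  by (induction k) (simp_all add: algebra_simps power2_eq_square)

lemma card_stairs:
  "int (card (stairs n)) = (int n + 3) * 2 ^ n - (int n)\<^sup>2 - 3 * int n - 3"
proof -
  define c where "c m = card (SIGMA S:Pow {..<m}. {1..n - card S})" for m :: nat
  have "card (stairs n) = (\<Sum>m<n. (n - m) * c m)"
    unfolding stairs_def c_def by (subst card_SigmaI) (auto simp: card_cartesian_product)
  then have "2 * int (card (stairs n)) = (\<Sum>m<n. int (n - m) * (2 * int (c m)))"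
    by (simp add: sum_distrib_left mult.left_commute)
  also have "\<dots> = (\<Sum>m<n. (int n - int m) * ((2 * int n - int m) * 2 ^ m))"
    unfolding c_def
    by (intro sum.cong refl) (simp only: lessThan_iff card_climb_sets_with_start of_nat_diff less_imp_le)
  also have "\<dots> = 2 * ((int n + 3) * 2 ^ n - (int n)\<^sup>2 - 3 * int n - 3)"
    unfolding sum_quadratic_times_power by (simp add: algebra_simps power2_eq_square)
  finally show ?thesis by simp
qed

theorem theorem3:
  fixes n :: nat
  assumes "n \<ge> 1"
  shows "int (order (PIO n)) = (int n + 3) * 2 ^ n - (int n)\<^sup>2 - 3 * int n - 2"
  by (simp add: order_PIO_eq card_stairs)

end
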